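(* Let $R$ be a commutative ring with unity. For every finite poset $X$, the incidence algebra $I(X,R)$ is two-sided zero product determined; that is, for every $R$-module $V$ and every $R$-bilinear map $\Phi:I(X,R)\times I(X,R)\to V$ satisfying $\Phi(a,b)=0$ whenever $ab=ba=0$, there exist $R$-linear maps $\tau_1,\tau_2:I(X,R)\to V$ such that $\Phi(f,g)=\tau_1(fg)+\tau_2(gf)$ for all $f,g\in I(X,R)$.
   Context: The incidence algebra $I(X,R)$ of a finite poset $X$ is the $R$-module of functions $f:X\times X\to R$ with $f(x,y)=0$ if $x\nleq y$, with multiplication $(fg)(x,y)=\sum_{x\le z\le y}f(x,z)g(z,y)$. *)

theory Defs
  imports "HOL-Algebra.Module"
begin

text \<open>
  The poset is a set \<open>X\<close> with an order relation \<open>r\<close>, where \<open>(x, y) \<in> r\<close> means \<open>x \<le> y\<close>.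
  A function on \<open>X \<times> X\<close> is represented by its extensional extension, which makes equality of
  elements of the algebra the same as equality of functions on \<open>X \<times> X\<close>.
\<close>

definition incidence_algebra ::
    "'x set \<Rightarrow> 'x rel \<Rightarrow> ('r, 'm) ring_scheme \<Rightarrow> ('r, 'x \<times> 'x \<Rightarrow> 'r) module" where
  "incidence_algebra X r R =
    \<lparr> carrier = {f \<in> X \<times> X \<rightarrow>\<^sub>E carrier R. \<forall>x\<in>X. \<forall>y\<in>X. (x, y) \<notin> r \<longrightarrow> f (x, y) = \<zero>\<^bsub>R\<^esub>},
      mult = (\<lambda>f g. \<lambda>(x, y)\<in>X \<times> X.
                \<Oplus>\<^bsub>R\<^esub>z\<in>{z \<in> X. (x, z) \<in> r \<and> (z, y) \<in> r}. f (x, z) \<otimes>\<^bsub>R\<^esub> g (z, y)),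
      one = (\<lambda>(x, y)\<in>X \<times> X. if x = y then \<one>\<^bsub>R\<^esub> else \<zero>\<^bsub>R\<^esub>),
      zero = (\<lambda>p\<in>X \<times> X. \<zero>\<^bsub>R\<^esub>),
      add = (\<lambda>f g. \<lambda>p\<in>X \<times> X. f p \<oplus>\<^bsub>R\<^esub> g p),
      smult = (\<lambda>c f. \<lambda>p\<in>X \<times> X. c \<otimes>\<^bsub>R\<^esub> f p) \<rparr>"

definition linear_map_on ::
    "('r, 'm) ring_scheme \<Rightarrow> ('r, 'a) module \<Rightarrow> ('r, 'v) module \<Rightarrow> ('a \<Rightarrow> 'v) \<Rightarrow> bool" where
  "linear_map_on R A V T \<longleftrightarrow>
    T \<in> carrier A \<rightarrow> carrier V \<and>
    (\<forall>a\<in>carrier A. \<forall>b\<in>carrier A. T (a \<oplus>\<^bsub>A\<^esub> b) = T a \<oplus>\<^bsub>V\<^esub> T b) \<and>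
    (\<forall>c\<in>carrier R. \<forall>a\<in>carrier A. T (c \<odot>\<^bsub>A\<^esub> a) = c \<odot>\<^bsub>V\<^esub> T a)"

definition bilinear_map_on ::
    "('r, 'm) ring_scheme \<Rightarrow> ('r, 'a) module \<Rightarrow> ('r, 'b) module \<Rightarrow> ('r, 'v) module \<Rightarrow>
      ('a \<Rightarrow> 'b \<Rightarrow> 'v) \<Rightarrow> bool" where
  "bilinear_map_on R A B V \<Phi> \<longleftrightarrow>
    (\<forall>a\<in>carrier A. linear_map_on R B V (\<lambda>b. \<Phi> a b)) \<and>
    (\<forall>b\<in>carrier B. linear_map_on R A V (\<lambda>a. \<Phi> a b))"

text \<open>
  A quantifier inside the definition cannot range over types, so the type \<open>'v\<close> carrying the
  target modules is a parameter; the property for all modules is the statement with \<open>'v\<close>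
  arbitrary. The fields \<open>mult\<close> and \<open>one\<close> of the record \<open>V\<close> play no role.
\<close>

definition two_sided_zero_product_determined ::
    "'v itself \<Rightarrow> ('r, 'm) ring_scheme \<Rightarrow> ('r, 'a) module \<Rightarrow> bool" where
  "two_sided_zero_product_determined (_ :: 'v itself) R A \<longleftrightarrow>
    (\<forall>(V :: ('r, 'v) module) \<Phi>.
      module R V \<and> bilinear_map_on R A A V \<Phi> \<and>
      (\<forall>a\<in>carrier A. \<forall>b\<in>carrier A.
        a \<otimes>\<^bsub>A\<^esub> b = \<zero>\<^bsub>A\<^esub> \<and> b \<otimes>\<^bsub>A\<^esub> a = \<zero>\<^bsub>A\<^esub> \<longrightarrow> \<Phi> a b = \<zero>\<^bsub>V\<^esub>) \<longrightarrow>
      (\<exists>\<tau>\<^sub>1 \<tau>\<^sub>2. linear_map_on R A V \<tau>\<^sub>1 \<and> linear_map_on R A V \<tau>\<^sub>2 \<and>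
        (\<forall>f\<in>carrier A. \<forall>g\<in>carrier A.
          \<Phi> f g = \<tau>\<^sub>1 (f \<otimes>\<^bsub>A\<^esub> g) \<oplus>\<^bsub>V\<^esub> \<tau>\<^sub>2 (g \<otimes>\<^bsub>A\<^esub> f))))"

end

theory Submission
  imports Defs
begin

text \<open>
  By bilinearity it suffices to treat matrix units, written \<open>e\<^sub>x\<^sub>y\<close> for \<open>x \<le> y\<close>. If \<open>y \<noteq> z\<close> and
  \<open>w \<noteq> x\<close> then \<open>\<Phi>(e\<^sub>x\<^sub>y, e\<^sub>z\<^sub>w) = 0\<close>, both products being zero. If \<open>x \<noteq> w\<close> and \<open>y \<noteq> y'\<close>, the elements
  \<open>e\<^sub>x\<^sub>y + e\<^sub>x\<^sub>y\<^sub>'\<close> and \<open>e\<^sub>y\<^sub>w - e\<^sub>y\<^sub>'\<^sub>w\<close> annihilate each other on both sides, which makes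
  \<open>\<Phi>(e\<^sub>x\<^sub>y, e\<^sub>y\<^sub>w)\<close> independent of \<open>y\<close>; take it as the value of \<open>\<tau>\<^sub>1\<close> at \<open>e\<^sub>x\<^sub>w\<close>. The same argument for
  \<open>(a, b) \<mapsto> \<Phi>(b, a)\<close> gives \<open>\<tau>\<^sub>2\<close> off the diagonal. On the diagonal only
  \<open>\<Phi>(e\<^sub>x\<^sub>x, e\<^sub>x\<^sub>x) = \<tau>\<^sub>1(e\<^sub>x\<^sub>x) + \<tau>\<^sub>2(e\<^sub>x\<^sub>x)\<close> is required, so \<open>\<tau>\<^sub>2\<close> is set to zero there.
\<close>

section \<open>Linear and bilinear maps between modules\<close>

lemma linear_map_on_closed:
  "linear_map_on R A V T \<Longrightarrow> a \<in> carrier A \<Longrightarrow> T a \<in> carrier V"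
  by (auto simp: linear_map_on_def)

lemma linear_map_on_add:
  "linear_map_on R A V T \<Longrightarrow> a \<in> carrier A \<Longrightarrow> b \<in> carrier A \<Longrightarrow>
    T (a \<oplus>\<^bsub>A\<^esub> b) = T a \<oplus>\<^bsub>V\<^esub> T b"
  by (simp add: linear_map_on_def)

lemma linear_map_on_smult:
  "linear_map_on R A V T \<Longrightarrow> c \<in> carrier R \<Longrightarrow> a \<in> carrier A \<Longrightarrow>
    T (c \<odot>\<^bsub>A\<^esub> a) = c \<odot>\<^bsub>V\<^esub> T a"
  by (simp add: linear_map_on_def)

lemma linear_map_on_comp:
  "linear_map_on R A B S \<Longrightarrow> linear_map_on R B V T \<Longrightarrow> linear_map_on R A V (\<lambda>a. T (S a))"
  by (auto simp: linear_map_on_def Pi_iff)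

lemma linear_map_on_zero:
  assumes "module R A" "module R V" "linear_map_on R A V T"
  shows "T \<zero>\<^bsub>A\<^esub> = \<zero>\<^bsub>V\<^esub>"
proof -
  interpret A: module R A by fact
  interpret V: module R V by fact
  have "T \<zero>\<^bsub>A\<^esub> = T (\<zero>\<^bsub>R\<^esub> \<odot>\<^bsub>A\<^esub> \<zero>\<^bsub>A\<^esub>)" by simp
  also have "\<dots> = \<zero>\<^bsub>R\<^esub> \<odot>\<^bsub>V\<^esub> T \<zero>\<^bsub>A\<^esub>"
    by (rule linear_map_on_smult[OF assms(3)]) auto
  finally show ?thesis using linear_map_on_closed[OF assms(3)] by simp
qed

lemma linear_map_on_minus:
  assumes "module R A" "module R V" "linear_map_on R A V T" "a \<in> carrier A" "b \<in> carrier A"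
  shows "T (a \<ominus>\<^bsub>A\<^esub> b) = T a \<ominus>\<^bsub>V\<^esub> T b"
proof -
  interpret A: module R A by fact
  interpret V: module R V by fact
  \<comment> \<open>Linearity provides only sums and scalars, so the negative is taken as the
    multiple by \<open>\<ominus> \<one>\<close>.\<close>
  have "T (\<ominus>\<^bsub>A\<^esub> b) = T ((\<ominus>\<^bsub>R\<^esub> \<one>\<^bsub>R\<^esub>) \<odot>\<^bsub>A\<^esub> b)"
    using assms(5) by (simp add: A.smult_l_minus)
  also have "\<dots> = \<ominus>\<^bsub>V\<^esub> T b"
    using linear_map_on_closed[OF assms(3)] assms(5)
    by (simp add: linear_map_on_smult[OF assms(3)] V.smult_l_minus)
  finally show ?thesis
    using assms(4,5) by (simp add: a_minus_def linear_map_on_add[OF assms(3)])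
qed

lemma linear_map_on_sum:
  assumes "module R V" "linear_map_on R A V S" "linear_map_on R A V T"
  shows "linear_map_on R A V (\<lambda>a. S a \<oplus>\<^bsub>V\<^esub> T a)"
proof -
  interpret V: module R V by fact
  show ?thesis
    using assms(2,3) by (auto simp: linear_map_on_def Pi_iff V.smult_r_distr V.a_ac)
qed

lemma bilinear_map_onD:
  assumes "bilinear_map_on R A B V \<Phi>"
  shows "a \<in> carrier A \<Longrightarrow> linear_map_on R B V (\<lambda>b. \<Phi> a b)"
    and "b \<in> carrier B \<Longrightarrow> linear_map_on R A V (\<lambda>a. \<Phi> a b)"
  using assms by (auto simp: bilinear_map_on_def)

lemma bilinear_map_on_closed:
  "bilinear_map_on R A B V \<Phi> \<Longrightarrow> a \<in> carrier A \<Longrightarrow> b \<in> carrier B \<Longrightarrow> \<Phi> a b \<in> carrier V"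
  using linear_map_on_closed bilinear_map_onD(1) by fastforce

lemma bilinear_map_on_flip:
  "bilinear_map_on R A B V \<Phi> \<Longrightarrow> bilinear_map_on R B A V (\<lambda>b a. \<Phi> a b)"
  by (auto simp: bilinear_map_on_def)

lemma bilinear_map_on_comp:
  "bilinear_map_on R A B C \<Psi> \<Longrightarrow> linear_map_on R C V T \<Longrightarrow>
    bilinear_map_on R A B V (\<lambda>a b. T (\<Psi> a b))"
  by (auto simp: bilinear_map_on_def intro: linear_map_on_comp)

lemma bilinear_map_on_sum:
  "module R V \<Longrightarrow> bilinear_map_on R A B V \<Phi> \<Longrightarrow> bilinear_map_on R A B V \<Psi> \<Longrightarrow>
    bilinear_map_on R A B V (\<lambda>a b. \<Phi> a b \<oplus>\<^bsub>V\<^esub> \<Psi> a b)"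
  by (auto simp: bilinear_map_on_def intro: linear_map_on_sum)

text \<open>Of the four terms of the expansion, the two cross terms are zero by assumption. With
  sums and differences of matrix units as arguments this evaluates the product in both orders, and
  then \<open>\<Phi>\<close> itself.\<close>

lemma bilinear_map_on_add_minus:
  assumes "module R B" "module R V" "bilinear_map_on R A B V \<Phi>"
    and "a \<in> carrier A" "a' \<in> carrier A" "a \<oplus>\<^bsub>A\<^esub> a' \<in> carrier A"
    and "b \<in> carrier B" "b' \<in> carrier B"
    and "\<Phi> a b' = \<zero>\<^bsub>V\<^esub>" "\<Phi> a' b = \<zero>\<^bsub>V\<^esub>"
  shows "\<Phi> (a \<oplus>\<^bsub>A\<^esub> a') (b \<ominus>\<^bsub>B\<^esub> b') = \<Phi> a b \<ominus>\<^bsub>V\<^esub> \<Phi> a' b'"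
proof -
  interpret V: module R V by fact
  note lin = bilinear_map_onD[OF assms(3)]
  have "\<Phi> (a \<oplus>\<^bsub>A\<^esub> a') (b \<ominus>\<^bsub>B\<^esub> b') = \<Phi> (a \<oplus>\<^bsub>A\<^esub> a') b \<ominus>\<^bsub>V\<^esub> \<Phi> (a \<oplus>\<^bsub>A\<^esub> a') b'"
    using linear_map_on_minus[OF assms(1,2) lin(1)] assms by blast
  also have "\<Phi> (a \<oplus>\<^bsub>A\<^esub> a') b = \<Phi> a b"
    using linear_map_on_add[OF lin(2)] bilinear_map_on_closed[OF assms(3)] assms by simp
  also have "\<Phi> (a \<oplus>\<^bsub>A\<^esub> a') b' = \<Phi> a' b'"
    using linear_map_on_add[OF lin(2)] bilinear_map_on_closed[OF assms(3)] assms by simp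
  finally show ?thesis .
qed

section \<open>The incidence algebra as a module with bilinear multiplication\<close>

locale finite_poset_incidence = cring R for R (structure) +
  fixes X :: "'x set" and r :: "'x rel"
  assumes finite_X: "finite X"
    and order: "partial_order_on X r"
begin

abbreviation A where "A \<equiv> incidence_algebra X r R"

abbreviation interval where "interval x y \<equiv> {z \<in> X. (x, z) \<in> r \<and> (z, y) \<in> r}"

text \<open>For \<open>p = (x, y)\<close> this is the unit written \<open>e\<^sub>x\<^sub>y\<close>
  above. Restricting to \<open>X \<times> X\<close> makes it extensional, as elements of the carrier
  have to be.\<close>

definition matrix_unit :: "'x \<times> 'x \<Rightarrow> 'x \<times> 'x \<Rightarrow> 'a" where
  "matrix_unit p = (\<lambda>q\<in>X \<times> X. if q = p then \<one> else \<zero>)"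

lemma order_facts:
  shows r_sub: "r \<subseteq> X \<times> X"
    and r_refl: "x \<in> X \<Longrightarrow> (x, x) \<in> r"
    and r_trans: "(x, y) \<in> r \<Longrightarrow> (y, z) \<in> r \<Longrightarrow> (x, z) \<in> r"
    and r_antisym: "(x, y) \<in> r \<Longrightarrow> (y, x) \<in> r \<Longrightarrow> x = y"
  using partial_order_onD[OF order] by (auto dest: refl_onD transD antisymD)

lemma finite_r: "finite r"
  using finite_X r_sub finite_subset by blast

lemma finite_interval [simp]: "finite (interval x y)"
  using finite_X by simp

lemma in_carrier_iff:
  "f \<in> carrier A \<longleftrightarrow>
    f \<in> extensional (X \<times> X) \<and> (\<forall>p\<in>X \<times> X. f p \<in> carrier R) \<and> (\<forall>p\<in>X \<times> X. p \<notin> r \<longrightarrow> f p = \<zero>)"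
  by (auto simp: incidence_algebra_def PiE_iff)

lemma coeff_closed: "f \<in> carrier A \<Longrightarrow> x \<in> X \<Longrightarrow> y \<in> X \<Longrightarrow> f (x, y) \<in> carrier R"
  by (auto simp: in_carrier_iff)

lemma carrier_eqI:
  assumes "f \<in> carrier A" "g \<in> carrier A"
    and "\<And>x y. x \<in> X \<Longrightarrow> y \<in> X \<Longrightarrow> f (x, y) = g (x, y)"
  shows "f = g"
  using assms by (intro extensionalityI[of f "X \<times> X"]) (auto simp: in_carrier_iff)

lemma add_A: "f \<oplus>\<^bsub>A\<^esub> g = (\<lambda>p\<in>X \<times> X. f p \<oplus> g p)"
  and zero_A: "\<zero>\<^bsub>A\<^esub> = (\<lambda>p\<in>X \<times> X. \<zero>)"
  and smult_A: "c \<odot>\<^bsub>A\<^esub> f = (\<lambda>p\<in>X \<times> X. c \<otimes> f p)"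
  by (simp_all add: incidence_algebra_def)

lemma mult_A_apply:
  "x \<in> X \<Longrightarrow> y \<in> X \<Longrightarrow>
    (f \<otimes>\<^bsub>A\<^esub> g) (x, y) = (\<Oplus>z\<in>interval x y. f (x, z) \<otimes> g (z, y))"
  by (simp add: incidence_algebra_def)

lemma add_A_closed: "f \<in> carrier A \<Longrightarrow> g \<in> carrier A \<Longrightarrow> f \<oplus>\<^bsub>A\<^esub> g \<in> carrier A"
  and zero_A_closed: "\<zero>\<^bsub>A\<^esub> \<in> carrier A"
  and smult_A_closed: "c \<in> carrier R \<Longrightarrow> f \<in> carrier A \<Longrightarrow> c \<odot>\<^bsub>A\<^esub> f \<in> carrier A"
  by (auto simp: in_carrier_iff add_A zero_A smult_A)

text \<open>The support stays inside \<open>r\<close> by transitivity: if \<open>(x, y)\<close> is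
  not in \<open>r\<close>, no \<open>z\<close> lies between \<open>x\<close> and \<open>y\<close>,
  and the sum is empty.\<close>

lemma mult_A_closed:
  assumes "f \<in> carrier A" "g \<in> carrier A"
  shows "f \<otimes>\<^bsub>A\<^esub> g \<in> carrier A"
proof -
  have "(f \<otimes>\<^bsub>A\<^esub> g) (x, y) \<in> carrier R" if "x \<in> X" "y \<in> X" for x y
    using that assms by (auto simp: mult_A_apply coeff_closed intro!: finsum_closed)
  moreover have "(f \<otimes>\<^bsub>A\<^esub> g) (x, y) = \<zero>" if "x \<in> X" "y \<in> X" "(x, y) \<notin> r" for x y
  proof -
    have "interval x y = {}" using that r_trans by blast
    then show ?thesis by (simp add: mult_A_apply[OF that(1,2)] del: Collect_empty_eq)
  qed
  moreover have "f \<otimes>\<^bsub>A\<^esub> g \<in> extensional (X \<times> X)"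
    by (simp add: incidence_algebra_def)
  ultimately show ?thesis by (auto simp: in_carrier_iff)
qed

lemma module_A: "module R A"
proof (rule moduleI)
  show "abelian_group A"
  proof (rule abelian_groupI)
    fix f assume f: "f \<in> carrier A"
    \<comment> \<open>The additive inverse is a scalar multiple of \<open>f\<close>, so it lies in
      the carrier by closure under scalars.\<close>
    have "(\<ominus> \<one>) \<odot>\<^bsub>A\<^esub> f \<oplus>\<^bsub>A\<^esub> f = \<zero>\<^bsub>A\<^esub>"
      using f by (intro carrier_eqI add_A_closed smult_A_closed zero_A_closed)
        (auto simp: add_A smult_A zero_A coeff_closed l_minus l_neg)
    then show "\<exists>g\<in>carrier A. g \<oplus>\<^bsub>A\<^esub> f = \<zero>\<^bsub>A\<^esub>"
      using smult_A_closed[OF _ f] by blast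
  qed (intro carrier_eqI add_A_closed zero_A_closed;
      auto simp: add_A zero_A coeff_closed a_ac)+
qed (intro carrier_eqI add_A_closed smult_A_closed is_cring;
    auto simp: add_A smult_A coeff_closed l_distr r_distr m_assoc)+

text \<open>Each law is checked coefficientwise, term by term in the sum over the interval. In the
  right factor a scalar has to pass the left coefficient, which uses commutativity of
  \<open>R\<close>. Stated as bilinearity, this lets the general lemmas treat the product and
  \<open>\<Phi>\<close> alike.\<close>

lemma bilinear_mult: "bilinear_map_on R A A A (\<lambda>f g. f \<otimes>\<^bsub>A\<^esub> g)"
proof -
  have 1: "f \<otimes>\<^bsub>A\<^esub> (g \<oplus>\<^bsub>A\<^esub> h) = f \<otimes>\<^bsub>A\<^esub> g \<oplus>\<^bsub>A\<^esub> f \<otimes>\<^bsub>A\<^esub> h"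
    if "f \<in> carrier A" "g \<in> carrier A" "h \<in> carrier A" for f g h
  proof (intro carrier_eqI add_A_closed mult_A_closed that)
    fix x y assume "x \<in> X" "y \<in> X"
    then show "(f \<otimes>\<^bsub>A\<^esub> (g \<oplus>\<^bsub>A\<^esub> h)) (x, y) = (f \<otimes>\<^bsub>A\<^esub> g \<oplus>\<^bsub>A\<^esub> f \<otimes>\<^bsub>A\<^esub> h) (x, y)"
      using that by (auto simp: add_A mult_A_apply coeff_closed r_distr Pi_def
          simp flip: finsum_addf intro!: finsum_cong')
  qed
  have 2: "(g \<oplus>\<^bsub>A\<^esub> h) \<otimes>\<^bsub>A\<^esub> f = g \<otimes>\<^bsub>A\<^esub> f \<oplus>\<^bsub>A\<^esub> h \<otimes>\<^bsub>A\<^esub> f"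
    if "f \<in> carrier A" "g \<in> carrier A" "h \<in> carrier A" for f g h
  proof (intro carrier_eqI add_A_closed mult_A_closed that)
    fix x y assume "x \<in> X" "y \<in> X"
    then show "((g \<oplus>\<^bsub>A\<^esub> h) \<otimes>\<^bsub>A\<^esub> f) (x, y) = (g \<otimes>\<^bsub>A\<^esub> f \<oplus>\<^bsub>A\<^esub> h \<otimes>\<^bsub>A\<^esub> f) (x, y)"
      using that by (auto simp: add_A mult_A_apply coeff_closed l_distr Pi_def
          simp flip: finsum_addf intro!: finsum_cong')
  qed
  have 3: "f \<otimes>\<^bsub>A\<^esub> (c \<odot>\<^bsub>A\<^esub> g) = c \<odot>\<^bsub>A\<^esub> (f \<otimes>\<^bsub>A\<^esub> g)"
    if "c \<in> carrier R" "f \<in> carrier A" "g \<in> carrier A" for c f g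
  proof (intro carrier_eqI smult_A_closed mult_A_closed that)
    fix x y assume "x \<in> X" "y \<in> X"
    then show "(f \<otimes>\<^bsub>A\<^esub> (c \<odot>\<^bsub>A\<^esub> g)) (x, y) = (c \<odot>\<^bsub>A\<^esub> (f \<otimes>\<^bsub>A\<^esub> g)) (x, y)"
      using that by (auto simp: smult_A mult_A_apply coeff_closed m_lcomm Pi_def
          finsum_rdistr intro!: finsum_cong')
  qed
  have 4: "(c \<odot>\<^bsub>A\<^esub> g) \<otimes>\<^bsub>A\<^esub> f = c \<odot>\<^bsub>A\<^esub> (g \<otimes>\<^bsub>A\<^esub> f)"
    if "c \<in> carrier R" "f \<in> carrier A" "g \<in> carrier A" for c f g
  proof (intro carrier_eqI smult_A_closed mult_A_closed that)
    fix x y assume "x \<in> X" "y \<in> X"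
    then show "((c \<odot>\<^bsub>A\<^esub> g) \<otimes>\<^bsub>A\<^esub> f) (x, y) = (c \<odot>\<^bsub>A\<^esub> (g \<otimes>\<^bsub>A\<^esub> f)) (x, y)"
      using that by (auto simp: smult_A mult_A_apply coeff_closed m_assoc Pi_def
          finsum_rdistr intro!: finsum_cong')
  qed
  show ?thesis
    by (auto simp: bilinear_map_on_def linear_map_on_def mult_A_closed 1 2 3 4)
qed

section \<open>Matrix units and their products\<close>

lemma matrix_unit_closed: "p \<in> r \<Longrightarrow> matrix_unit p \<in> carrier A"
  by (auto simp: in_carrier_iff matrix_unit_def)

lemma matrix_unit_apply:
  "q \<in> X \<times> X \<Longrightarrow> matrix_unit p q = (if q = p then \<one> else \<zero>)"
  by (simp add: matrix_unit_def)

lemma matrix_unit_mult: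
  assumes "(x, y) \<in> r" "(z, w) \<in> r"
  shows "matrix_unit (x, y) \<otimes>\<^bsub>A\<^esub> matrix_unit (z, w) =
    (if y = z then matrix_unit (x, w) else \<zero>\<^bsub>A\<^esub>)"
proof (rule carrier_eqI)
  show "matrix_unit (x, y) \<otimes>\<^bsub>A\<^esub> matrix_unit (z, w) \<in> carrier A"
    using assms by (intro mult_A_closed matrix_unit_closed)
  show "(if y = z then matrix_unit (x, w) else \<zero>\<^bsub>A\<^esub>) \<in> carrier A"
    using assms r_trans by (auto intro: matrix_unit_closed zero_A_closed)
next
  fix a b assume ab: "a \<in> X" "b \<in> X"
  have y: "y \<in> X" using assms r_sub by auto
  \<comment> \<open>Only \<open>c = y\<close> can contribute, and the remaining condition does not
    depend on \<open>c\<close>. If that condition holds, \<open>y\<close> lies in the interval and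
    the sum has the single term \<open>\<one>\<close>; if it fails, every term is zero, whether or
    not \<open>y\<close> is in the interval.\<close>
  have "(matrix_unit (x, y) \<otimes>\<^bsub>A\<^esub> matrix_unit (z, w)) (a, b) =
      (\<Oplus>c\<in>interval a b. if y = c then (if a = x \<and> y = z \<and> b = w then \<one> else \<zero>) else \<zero>)"
    unfolding mult_A_apply[OF ab]
    using ab y by (intro finsum_cong') (auto simp: matrix_unit_apply)
  also have "\<dots> = (if a = x \<and> y = z \<and> b = w then \<one> else \<zero>)"
  proof (cases "a = x \<and> y = z \<and> b = w")
    case True
    then have "y \<in> interval a b" using assms y by auto
    from finsum_singleton[OF this finite_interval, of "\<lambda>_. \<one>"] show ?thesis
      using True by simp
  next
    case False
    then show ?thesis by (simp only: if_not_P if_False if_cancel finsum_zero)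
  qed
  also have "\<dots> = (if y = z then matrix_unit (x, w) else \<zero>\<^bsub>A\<^esub>) (a, b)"
    using ab by (auto simp: matrix_unit_apply zero_A)
  finally show "(matrix_unit (x, y) \<otimes>\<^bsub>A\<^esub> matrix_unit (z, w)) (a, b) =
    (if y = z then matrix_unit (x, w) else \<zero>\<^bsub>A\<^esub>) (a, b)" .
qed

section \<open>Reduction of identities to matrix units\<close>

text \<open>The matrix units indexed by \<open>r\<close> span the algebra, since \<open>r\<close> is
  finite and every element vanishes off \<open>r\<close>.\<close>

lemma linear_map_on_eqI:
  assumes V: "module R V" and S: "linear_map_on R A V S" and T: "linear_map_on R A V T"
    and eq: "\<And>p. p \<in> r \<Longrightarrow> S (matrix_unit p) = T (matrix_unit p)"
    and f: "f \<in> carrier A"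
  shows "S f = T f"
proof -
  interpret V: module R V by fact
  \<comment> \<open>Functions vanishing off a subset \<open>P\<close> of \<open>r\<close> allow
    induction on \<open>P\<close>, one entry at a time; \<open>P = r\<close> covers the whole
    algebra.\<close>
  have "S g = T g" if "P \<subseteq> r" "g \<in> carrier A" "\<And>p. p \<in> X \<times> X \<Longrightarrow> p \<notin> P \<Longrightarrow> g p = \<zero>" for P g
    using finite_subset[OF that(1) finite_r] that
  proof (induction P arbitrary: g rule: finite_induct)
    case empty
    then have "g = \<zero>\<^bsub>A\<^esub>"
      by (intro carrier_eqI zero_A_closed) (auto simp: zero_A)
    then show ?case
      using linear_map_on_zero[OF module_A V S] linear_map_on_zero[OF module_A V T] by simp
  next
    case (insert p P)
    \<comment> \<open>Erasing the entry at \<open>p\<close> leaves a function that vanishes off the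
      smaller set, and \<open>g\<close> differs from it by a multiple of the matrix unit at
      \<open>p\<close>.\<close>
    define h where "h = g(p := \<zero>)"
    have p: "p \<in> r" "p \<in> X \<times> X" using insert.prems r_sub by auto
    have E: "matrix_unit p \<in> carrier A" using p by (simp add: matrix_unit_closed)
    have gp: "g p \<in> carrier R" using insert.prems(2) p(2) by (cases p) (auto intro: coeff_closed)
    have h: "h \<in> carrier A"
      using insert.prems(2) p by (auto simp: h_def in_carrier_iff extensional_def)
    have "S h = T h"
      using insert.prems by (intro insert.IH h) (auto simp: h_def)
    have g: "g = h \<oplus>\<^bsub>A\<^esub> g p \<odot>\<^bsub>A\<^esub> matrix_unit p"
      using insert.prems(2) h E gp
      by (intro carrier_eqI add_A_closed smult_A_closed)
        (auto simp: h_def add_A smult_A matrix_unit_apply coeff_closed)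
    have "U g = U h \<oplus>\<^bsub>V\<^esub> g p \<odot>\<^bsub>V\<^esub> U (matrix_unit p)"
      if "linear_map_on R A V U" for U
      by (subst g) (simp add: linear_map_on_add[OF that h smult_A_closed[OF gp E]]
          linear_map_on_smult[OF that gp E])
    from this[OF S] this[OF T] show ?case
      using \<open>S h = T h\<close> eq[OF p(1)] by simp
  qed
  from this[OF order.refl f] show ?thesis
    using f by (auto simp: in_carrier_iff)
qed

text \<open>The linear case is used twice: first in the second argument with a matrix unit in the
  first, then in the first argument with \<open>g\<close> fixed.\<close>

lemma bilinear_map_on_eqI:
  assumes V: "module R V" and \<Phi>: "bilinear_map_on R A A V \<Phi>" and \<Psi>: "bilinear_map_on R A A V \<Psi>"
    and eq: "\<And>p q. p \<in> r \<Longrightarrow> q \<in> r \<Longrightarrow>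
      \<Phi> (matrix_unit p) (matrix_unit q) = \<Psi> (matrix_unit p) (matrix_unit q)"
    and fg: "f \<in> carrier A" "g \<in> carrier A"
  shows "\<Phi> f g = \<Psi> f g"
proof -
  have "\<Phi> (matrix_unit p) g = \<Psi> (matrix_unit p) g" if p: "p \<in> r" for p
  proof -
    note E = matrix_unit_closed[OF p]
    show ?thesis
      using eq[OF p]
      by (rule linear_map_on_eqI[OF V bilinear_map_onD(1)[OF \<Phi> E] bilinear_map_onD(1)[OF \<Psi> E]
            _ fg(2)])
  qed
  then show ?thesis
    by (rule linear_map_on_eqI[OF V bilinear_map_onD(2)[OF \<Phi> fg(2)]
          bilinear_map_onD(2)[OF \<Psi> fg(2)] _ fg(1)])
qed

section \<open>Linear extension from matrix units, and independence of the factorization\<close>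

text \<open>The matrix units indexed by \<open>r\<close> are a basis in which \<open>f\<close> has
  coordinates \<open>f p\<close>, so this is the linear map with prescribed values \<open>v\<close>
  on that basis.\<close>

definition extend :: "('a, 'v) module \<Rightarrow> ('x \<times> 'x \<Rightarrow> 'v) \<Rightarrow> ('x \<times> 'x \<Rightarrow> 'a) \<Rightarrow> 'v" where
  "extend V v f = (\<Oplus>\<^bsub>V\<^esub>p\<in>r. f p \<odot>\<^bsub>V\<^esub> v p)"

lemma linear_extend:
  assumes "module R V" "v \<in> r \<rightarrow> carrier V"
  shows "linear_map_on R A V (extend V v)"
proof -
  interpret V: module R V by fact
  have coeff: "f p \<in> carrier R" if "f \<in> carrier A" "p \<in> r" for f p
    using that r_sub by (auto simp: in_carrier_iff)
  have v: "v p \<in> carrier V" if "p \<in> r" for p using that assms by auto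
  have X: "p \<in> X \<times> X" if "p \<in> r" for p using that r_sub by auto
  have add: "extend V v (f \<oplus>\<^bsub>A\<^esub> g) = extend V v f \<oplus>\<^bsub>V\<^esub> extend V v g"
    if "f \<in> carrier A" "g \<in> carrier A" for f g
  proof -
    have "extend V v f \<oplus>\<^bsub>V\<^esub> extend V v g = (\<Oplus>\<^bsub>V\<^esub>p\<in>r. f p \<odot>\<^bsub>V\<^esub> v p \<oplus>\<^bsub>V\<^esub> g p \<odot>\<^bsub>V\<^esub> v p)"
      unfolding extend_def using that by (intro V.finsum_addf[symmetric]) (auto simp: coeff v)
    also have "\<dots> = extend V v (f \<oplus>\<^bsub>A\<^esub> g)"
      unfolding extend_def using that
      by (intro V.finsum_cong') (auto simp: coeff v X add_A V.smult_l_distr restrict_apply)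
    finally show ?thesis ..
  qed
  have smult: "extend V v (c \<odot>\<^bsub>A\<^esub> f) = c \<odot>\<^bsub>V\<^esub> extend V v f"
    if "c \<in> carrier R" "f \<in> carrier A" for c f
  proof -
    have "c \<odot>\<^bsub>V\<^esub> extend V v f = (\<Oplus>\<^bsub>V\<^esub>p\<in>r. c \<odot>\<^bsub>V\<^esub> (f p \<odot>\<^bsub>V\<^esub> v p))"
      unfolding extend_def using that finite_r
      by (intro V.finsum_smult_ldistr) (auto simp: coeff v)
    also have "\<dots> = extend V v (c \<odot>\<^bsub>A\<^esub> f)"
      unfolding extend_def using that
      by (intro V.finsum_cong') (auto simp: coeff v X smult_A V.smult_assoc1 restrict_apply)
    finally show ?thesis ..
  qed
  have "extend V v f \<in> carrier V" if "f \<in> carrier A" for f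
    unfolding extend_def using that by (intro V.finsum_closed) (auto simp: coeff v)
  with add smult show ?thesis by (auto simp: linear_map_on_def)
qed

lemma extend_matrix_unit:
  assumes "module R V" "v \<in> r \<rightarrow> carrier V" "p \<in> r"
  shows "extend V v (matrix_unit p) = v p"
proof -
  interpret V: module R V by fact
  have v: "v q \<in> carrier V" if "q \<in> r" for q using that assms by auto
  have "extend V v (matrix_unit p) = (\<Oplus>\<^bsub>V\<^esub>q\<in>r. if p = q then v q else \<zero>\<^bsub>V\<^esub>)"
    unfolding extend_def using r_sub v
    by (intro V.finsum_cong') (auto simp: subset_iff matrix_unit_apply)
  also have "\<dots> = v p"
    using V.finsum_singleton[OF assms(3) finite_r assms(2)] .
  finally show ?thesis .
qed

text \<open>The assumption \<open>x \<noteq> w\<close> makes the reverse products vanish.\<close>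

lemma matrix_unit_factorization_indep:
  assumes V: "module R V" and \<Phi>: "bilinear_map_on R A A V \<Phi>"
    and zero: "\<And>a b. a \<in> carrier A \<Longrightarrow> b \<in> carrier A \<Longrightarrow>
      a \<otimes>\<^bsub>A\<^esub> b = \<zero>\<^bsub>A\<^esub> \<Longrightarrow> b \<otimes>\<^bsub>A\<^esub> a = \<zero>\<^bsub>A\<^esub> \<Longrightarrow> \<Phi> a b = \<zero>\<^bsub>V\<^esub>"
    and le: "(x, y) \<in> r" "(y, w) \<in> r" "(x, y') \<in> r" "(y', w) \<in> r" and "x \<noteq> w"
  shows "\<Phi> (matrix_unit (x, y)) (matrix_unit (y, w)) =
    \<Phi> (matrix_unit (x, y')) (matrix_unit (y', w))"
proof (cases "y = y'")
  case False
  interpret A: module R A by (rule module_A)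
  interpret V: module R V by fact
  note E = le[THEN matrix_unit_closed]
  let ?a = "matrix_unit (x, y) \<oplus>\<^bsub>A\<^esub> matrix_unit (x, y')"
  let ?b = "matrix_unit (y, w) \<ominus>\<^bsub>A\<^esub> matrix_unit (y', w)"
  have xw: "matrix_unit (x, w) \<in> carrier A"
    using le r_trans matrix_unit_closed by blast
  have ab: "?a \<in> carrier A" "?b \<in> carrier A"
    using E by simp_all
  \<comment> \<open>The cross products vanish because \<open>y \<noteq> y'\<close>. The other two
    are both the matrix unit at \<open>(x, w)\<close>, with opposite signs.\<close>
  have "?a \<otimes>\<^bsub>A\<^esub> ?b = \<zero>\<^bsub>A\<^esub>"
    using bilinear_map_on_add_minus[OF module_A module_A bilinear_mult E(1,3) ab(1) E(2,4)]
      le False xw by (simp add: matrix_unit_mult A.r_neg a_minus_def)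
  moreover have "?b \<otimes>\<^bsub>A\<^esub> ?a = \<zero>\<^bsub>A\<^esub>"
    using bilinear_map_on_add_minus[OF module_A module_A bilinear_map_on_flip[OF bilinear_mult]
        E(1,3) ab(1) E(2,4)] le \<open>x \<noteq> w\<close> by (simp add: matrix_unit_mult a_minus_def)
  ultimately have "\<Phi> ?a ?b = \<zero>\<^bsub>V\<^esub>"
    using zero ab by blast
  \<comment> \<open>Each mixed pair annihilates itself in both orders, by
    \<open>y \<noteq> y'\<close> and \<open>x \<noteq> w\<close>, so expanding
    \<open>\<Phi> ?a ?b\<close> leaves only the difference of the two values to be compared.\<close>
  moreover have "\<Phi> (matrix_unit (x, y)) (matrix_unit (y', w)) = \<zero>\<^bsub>V\<^esub>"
    "\<Phi> (matrix_unit (x, y')) (matrix_unit (y, w)) = \<zero>\<^bsub>V\<^esub>"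
    using E le False \<open>x \<noteq> w\<close> by (auto intro!: zero simp: matrix_unit_mult)
  ultimately have "\<Phi> (matrix_unit (x, y)) (matrix_unit (y, w)) \<ominus>\<^bsub>V\<^esub>
      \<Phi> (matrix_unit (x, y')) (matrix_unit (y', w)) = \<zero>\<^bsub>V\<^esub>"
    using bilinear_map_on_add_minus[OF module_A V \<Phi> E(1,3) ab(1) E(2,4)] by simp
  then show ?thesis
    using V.minus_equality V.minus_minus bilinear_map_on_closed[OF \<Phi>] E
    by (metis V.a_inv_closed a_minus_def)
qed simp

section \<open>Construction of the two linear maps and verification on matrix units\<close>

lemma incidence_algebra_two_sided_zpd:
  "two_sided_zero_product_determined TYPE('v) R A"
  unfolding two_sided_zero_product_determined_def
proof (intro allI impI, elim conjE)
  fix V :: "('a, 'v) module" and \<Phi>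
  assume V: "module R V" and \<Phi>: "bilinear_map_on R A A V \<Phi>"
    and "\<forall>a\<in>carrier A. \<forall>b\<in>carrier A.
      a \<otimes>\<^bsub>A\<^esub> b = \<zero>\<^bsub>A\<^esub> \<and> b \<otimes>\<^bsub>A\<^esub> a = \<zero>\<^bsub>A\<^esub> \<longrightarrow> \<Phi> a b = \<zero>\<^bsub>V\<^esub>"
  then have zero: "\<And>a b. a \<in> carrier A \<Longrightarrow> b \<in> carrier A \<Longrightarrow>
      a \<otimes>\<^bsub>A\<^esub> b = \<zero>\<^bsub>A\<^esub> \<Longrightarrow> b \<otimes>\<^bsub>A\<^esub> a = \<zero>\<^bsub>A\<^esub> \<Longrightarrow> \<Phi> a b = \<zero>\<^bsub>V\<^esub>" by blast
  interpret V: module R V by fact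
  let ?E = matrix_unit
  \<comment> \<open>The middle point is chosen to be the left end \<open>x\<close>, which is
    available for every pair in \<open>r\<close>. On the diagonal this gives the full value of
    \<open>\<Phi>\<close> at the idempotent.\<close>
  define v where "v = (\<lambda>(x, w). \<Phi> (?E (x, x)) (?E (x, w)))"
  \<comment> \<open>Here the product in reverse order counts: the unit at \<open>(z, y)\<close> is
    the unit at \<open>(z, z)\<close> times itself, and \<open>\<Phi>\<close> takes these factors
    swapped. The zero on the diagonal avoids counting the value in \<open>v\<close> twice.\<close>
  define u where "u = (\<lambda>(z, y). if z = y then \<zero>\<^bsub>V\<^esub> else \<Phi> (?E (z, y)) (?E (z, z)))"
  have diag: "(x, x) \<in> r" if "(x, y) \<in> r" for x y
    using that r_sub r_refl by blast
  have v: "v \<in> r \<rightarrow> carrier V" and u: "u \<in> r \<rightarrow> carrier V"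
    using diag by (auto simp: v_def u_def intro!: bilinear_map_on_closed[OF \<Phi>] matrix_unit_closed)
  note lin = linear_extend[OF V v] linear_extend[OF V u]
  \<comment> \<open>A product of two matrix units is a matrix unit or zero, so these are the only
    values of the two extensions that the case analysis meets.\<close>
  note unit = extend_matrix_unit[OF V v] extend_matrix_unit[OF V u]
    linear_map_on_zero[OF module_A V lin(1)] linear_map_on_zero[OF module_A V lin(2)]
  have "\<Phi> (?E (x, y)) (?E (z, w)) =
      extend V v (?E (x, y) \<otimes>\<^bsub>A\<^esub> ?E (z, w)) \<oplus>\<^bsub>V\<^esub> extend V u (?E (z, w) \<otimes>\<^bsub>A\<^esub> ?E (x, y))"
    if p: "(x, y) \<in> r" and q: "(z, w) \<in> r" for x y z w
  proof -
    note E = matrix_unit_closed[OF p] matrix_unit_closed[OF q]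
    have closed: "\<Phi> (?E (x, y)) (?E (z, w)) \<in> carrier V"
      by (rule bilinear_map_on_closed[OF \<Phi> E])
    consider "y = z" "w = x" | "y = z" "w \<noteq> x" | "y \<noteq> z" "w = x" | "y \<noteq> z" "w \<noteq> x" by blast
    then show ?thesis
    proof cases
      case 1
      \<comment> \<open>Here \<open>x \<le> y\<close> and \<open>y = z \<le> w = x\<close>, so all
        four indices coincide and only the diagonal values enter.\<close>
      then have "x = y" using p q r_antisym by blast
      with 1 p closed show ?thesis
        by (simp add: matrix_unit_mult unit) (simp add: v_def u_def)
    next
      case 2
      have xw: "(x, w) \<in> r" using 2 p q r_trans by blast
      \<comment> \<open>The middle point \<open>y\<close> is exchanged for the left end
        \<open>x\<close> used in \<open>v\<close>.\<close>
      have "\<Phi> (?E (x, y)) (?E (y, w)) = \<Phi> (?E (x, x)) (?E (x, w))"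
        by (rule matrix_unit_factorization_indep[OF V \<Phi>])
          (use zero 2 p q xw diag[OF p] in \<open>simp_all\<close>)
      then have "\<Phi> (?E (x, y)) (?E (z, w)) = v (x, w)"
        using 2 by (simp add: v_def)
      with 2 p q xw closed show ?thesis
        by (simp add: matrix_unit_mult unit)
    next
      case 3
      have zy: "(z, y) \<in> r" using 3 p q r_trans by blast
      \<comment> \<open>For the map with swapped arguments the chain is
        \<open>z \<le> x \<le> y\<close> with distinct ends, and its middle point \<open>x\<close>
        is exchanged for \<open>z\<close>. The condition on annihilating pairs is symmetric, so it
        holds for the swapped map as well.\<close>
      have "\<Phi> (?E (x, y)) (?E (z, x)) = \<Phi> (?E (z, y)) (?E (z, z))"
        by (rule matrix_unit_factorization_indep[OF V bilinear_map_on_flip[OF \<Phi>]])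
          (use zero 3 p q zy diag[OF q] in \<open>simp_all\<close>)
      then have "\<Phi> (?E (x, y)) (?E (z, w)) = u (z, y)"
        using 3 by (simp add: u_def)
      with 3 p q zy closed show ?thesis
        by (simp add: matrix_unit_mult unit)
    next
      case 4
      with p q E show ?thesis
        by (simp add: matrix_unit_mult unit zero)
    qed
  qed
  note on_units = this
  let ?\<Psi> = "\<lambda>f g. extend V v (f \<otimes>\<^bsub>A\<^esub> g) \<oplus>\<^bsub>V\<^esub> extend V u (g \<otimes>\<^bsub>A\<^esub> f)"
  have \<Psi>: "bilinear_map_on R A A V ?\<Psi>"
    by (rule bilinear_map_on_sum[OF V bilinear_map_on_comp[OF bilinear_mult lin(1)]
          bilinear_map_on_comp[OF bilinear_map_on_flip[OF bilinear_mult] lin(2)]])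
  have "\<Phi> (?E p) (?E q) = ?\<Psi> (?E p) (?E q)" if "p \<in> r" "q \<in> r" for p q
    using that on_units by (cases p; cases q) simp
  then have "\<Phi> f g = ?\<Psi> f g" if "f \<in> carrier A" "g \<in> carrier A" for f g
    by (rule bilinear_map_on_eqI[OF V \<Phi> \<Psi> _ that])
  with lin show "\<exists>\<tau>\<^sub>1 \<tau>\<^sub>2. linear_map_on R A V \<tau>\<^sub>1 \<and> linear_map_on R A V \<tau>\<^sub>2 \<and>
      (\<forall>f\<in>carrier A. \<forall>g\<in>carrier A. \<Phi> f g = \<tau>\<^sub>1 (f \<otimes>\<^bsub>A\<^esub> g) \<oplus>\<^bsub>V\<^esub> \<tau>\<^sub>2 (g \<otimes>\<^bsub>A\<^esub> f))"
    by (intro exI[of _ "extend V v"] exI[of _ "extend V u"] conjI ballI)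
qed

end

theorem theorem3p5:
  fixes R :: "('r, 'm) ring_scheme"
    and X :: "'x set"
    and r :: "'x rel"
  assumes "cring R"
    and "finite X"
    and "partial_order_on X r"
  shows "two_sided_zero_product_determined TYPE('v) R (incidence_algebra X r R)"
proof -
  interpret finite_poset_incidence R X r
    using assms by (intro finite_poset_incidence.intro finite_poset_incidence_axioms.intro)
  show ?thesis by (rule incidence_algebra_two_sided_zpd)
qed

end
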